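(* Let $\mathcal{H}$ be a finite-dimensional complex Hilbert space, let $H$ be a self-adjoint operator on $\mathcal{H}$ and let $(L_k)_k$ be a finite family of arbitrary linear operators on $\mathcal{H}$. Let $\rho=\rho(t)$ be a full-rank density operator on $\mathcal{H}$ and $\delta\rho=\delta\rho(t)$ a traceless Hermitian operator on $\mathcal{H}$, both following solutions of the Lindblad equation, i.e. $\tfrac{d}{dt}\rho=\mathcal{L}(\rho)$ and $\tfrac{d}{dt}\delta\rho=\mathcal{L}(\delta\rho)$ with $$\mathcal{L}(X) = -i[H,X]-\tfrac12\sum_k\left(L_k^\dagger L_k X + X L_k^\dagger L_k - 2L_k X L_k^\dagger\right).$$ For each fixed $s\in[0,1]$, let $\delta\omega_s=\delta\omega_s(t)$ be the solution, at each time, of the Sylvester equation $s\,\delta\omega_s\,\rho+\rho\,\delta\omega_s=\delta\rho$. Then for each fixed $s\in[0,1]$, $$\tfrac{d}{dt}\mathrm{Tr}(\delta\rho\,\delta\omega_s)=\tfrac{d}{dt}\mathrm{Tr}(\delta\rho\,\delta\omega_s^\dagger) = - s\sum_k \mathrm{Tr}\left([\delta\omega_s,L_k]\,\rho\,[\delta\omega_s,L_k]^\dagger\right)-\sum_k\mathrm{Tr}\left([\delta\omega_s^\dagger,L_k]\,\rho\,[\delta\omega_s^\dagger,L_k]^\dagger\right)\;\le\;0 .$$ Consequently, for every finite positive measure $m(s)\,ds$ on $[0,1]$, the metric $$\Vert\delta\rho\Vert_\rho^2=\int_0^1 \mathrm{Tr}\left(\delta\rho\,\frac{\delta\omega_s+\delta\omega_s^\dagger}{2}\right)m(s)\,ds$$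 is contractive under the Lindblad equation, i.e. $\Vert\delta\rho(t)\Vert_{\rho(t)}$ is non-increasing in $t$.
   Context: A density operator is a self-adjoint, positive semi-definite operator of trace one on $\mathcal{H}$; full rank means positive definite. $[A,B]=AB-BA$, and ${}^\dagger$ denotes the operator adjoint. The notation $m(s)\,ds$ stands for an arbitrary finite positive measure on $[0,1]$, which may have atoms (e.g. be concentrated at $s=0$ or at $s=1$). For $\rho$ positive definite and $s\ge 0$ the Sylvester equation $s\,\delta\omega_s\rho+\rho\,\delta\omega_s=\delta\rho$ has a unique solution $\delta\omega_s$. *)

theory Defs
  imports "HOL-Analysis.Analysis"
begin

(* The finite-dimensional Hilbert space is complex^'n with the form cinner below; operators on it
   are matrices of type complex^'n^'n. *)

definition cinner :: "complex^'n \<Rightarrow> complex^'n \<Rightarrow> complex" where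
  "cinner v w = (\<Sum>i\<in>UNIV. cnj (v $ i) * w $ i)"

definition dagger :: "complex^'n^'n \<Rightarrow> complex^'n^'n" where
  "dagger A = (\<chi> i j. cnj (A $ j $ i))"

lemma cinner_dagger: "cinner (dagger A *v v) w = cinner v (A *v w)"
proof -
  have "cinner (dagger A *v v) w = (\<Sum>i\<in>UNIV. \<Sum>j\<in>UNIV. A $ j $ i * cnj (v $ j) * w $ i)"
    by (simp add: cinner_def dagger_def matrix_vector_mult_def sum_distrib_right)
  also have "\<dots> = (\<Sum>j\<in>UNIV. \<Sum>i\<in>UNIV. A $ j $ i * cnj (v $ j) * w $ i)"
    by (rule sum.swap)
  also have "\<dots> = cinner v (A *v w)"
    by (simp add: cinner_def matrix_vector_mult_def sum_distrib_left mult_ac)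
  finally show ?thesis .
qed

definition commutator :: "complex^'n^'n \<Rightarrow> complex^'n^'n \<Rightarrow> complex^'n^'n" where
  "commutator A B = A ** B - B ** A"

definition self_adjoint :: "complex^'n^'n \<Rightarrow> bool" where
  "self_adjoint A \<longleftrightarrow> dagger A = A"

definition positive_semidefinite :: "complex^'n^'n \<Rightarrow> bool" where
  "positive_semidefinite A \<longleftrightarrow> self_adjoint A \<and> (\<forall>v. 0 \<le> Re (cinner v (A *v v)))"

definition positive_definite :: "complex^'n^'n \<Rightarrow> bool" where
  "positive_definite A \<longleftrightarrow> self_adjoint A \<and> (\<forall>v. v \<noteq> 0 \<longrightarrow> 0 < Re (cinner v (A *v v)))"

definition density_operator :: "complex^'n^'n \<Rightarrow> bool" where
  "density_operator A \<longleftrightarrow> positive_semidefinite A \<and> trace A = 1"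

(* mat c is the scalar matrix c * Id. *)
definition lindbladian ::
    "complex^'n^'n \<Rightarrow> 'k set \<Rightarrow> ('k \<Rightarrow> complex^'n^'n) \<Rightarrow> complex^'n^'n \<Rightarrow> complex^'n^'n" where
  "lindbladian H K L X =
     mat (- \<i>) ** commutator H X
     - (1/2) *\<^sub>R (\<Sum>k\<in>K. dagger (L k) ** L k ** X + X ** dagger (L k) ** L k
                          - 2 *\<^sub>R (L k ** X ** dagger (L k)))"

definition lindblad_solution_on ::
    "real set \<Rightarrow> complex^'n^'n \<Rightarrow> 'k set \<Rightarrow> ('k \<Rightarrow> complex^'n^'n) \<Rightarrow> (real \<Rightarrow> complex^'n^'n) \<Rightarrow> bool" where
  "lindblad_solution_on T H K L X \<longleftrightarrow>
     (\<forall>t\<in>T. (X has_vector_derivative lindbladian H K L (X t)) (at t within T))"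

definition sylvester :: "real \<Rightarrow> complex^'n^'n \<Rightarrow> complex^'n^'n \<Rightarrow> complex^'n^'n" where
  "sylvester s \<rho> X = s *\<^sub>R (X ** \<rho>) + \<rho> ** X"

(* The description operator is justified by sylvester_ex1 below. *)
definition sylvester_solution ::
    "real \<Rightarrow> complex^'n^'n \<Rightarrow> complex^'n^'n \<Rightarrow> complex^'n^'n" where
  "sylvester_solution s \<rho> \<delta>\<rho> = (THE X. sylvester s \<rho> X = \<delta>\<rho>)"

(* The trace below is real for self-adjoint \<delta>\<rho>, and the integrand is integrable for every finite
   measure on [0,1] (see integrable_metric_density), so neither Re nor the totality of the
   Bochner integral hides anything. *)
definition metric_density :: "complex^'n^'n \<Rightarrow> complex^'n^'n \<Rightarrow> real \<Rightarrow> real" where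
  "metric_density \<rho> \<delta>\<rho> s =
     (let \<omega> = sylvester_solution s \<rho> \<delta>\<rho>
      in Re (trace (\<delta>\<rho> ** ((1/2) *\<^sub>R (\<omega> + dagger \<omega>)))))"

definition metric_sq :: "real measure \<Rightarrow> complex^'n^'n \<Rightarrow> complex^'n^'n \<Rightarrow> real" where
  "metric_sq m \<rho> \<delta>\<rho> = (LINT s|m. metric_density \<rho> \<delta>\<rho> s)"

definition metric_norm :: "real measure \<Rightarrow> complex^'n^'n \<Rightarrow> complex^'n^'n \<Rightarrow> real" where
  "metric_norm m \<rho> \<delta>\<rho> = sqrt (metric_sq m \<rho> \<delta>\<rho>)"

definition finite_measure_on_unit_interval :: "real measure \<Rightarrow> bool" where
  "finite_measure_on_unit_interval m \<longleftrightarrow>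
     finite_measure m \<and> sets m = sets (restrict_space borel {0..1})"


lemma linear_sylvester:
  fixes \<rho> :: "complex^'n^'n"
  shows "linear (sylvester s \<rho>)"
proof (rule linearI)
  fix X Y :: "complex^'n^'n" and r :: real
  have "(X + Y) ** \<rho> = X ** \<rho> + Y ** \<rho>"
    by (simp add: vec_eq_iff matrix_matrix_mult_def distrib_right sum.distrib)
  then show "sylvester s \<rho> (X + Y) = sylvester s \<rho> X + sylvester s \<rho> Y"
    by (simp add: sylvester_def matrix_add_ldistrib scaleR_add_right)
  have "(r *\<^sub>R X) ** \<rho> = r *\<^sub>R (X ** \<rho>)" "\<rho> ** (r *\<^sub>R X) = r *\<^sub>R (\<rho> ** X)"
    by (simp_all add: vec_eq_iff matrix_matrix_mult_def scaleR_sum_right)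
  then show "sylvester s \<rho> (r *\<^sub>R X) = r *\<^sub>R sylvester s \<rho> X"
    by (simp add: sylvester_def scaleR_add_right)
qed

lemma inner_mult_left:
  fixes Y \<rho> :: "complex^'n^'n"
  shows "Y \<bullet> (\<rho> ** Y) = (\<Sum>j\<in>UNIV. Re (cinner (column j Y) (\<rho> *v column j Y)))"
proof -
  have "Y \<bullet> (\<rho> ** Y) = (\<Sum>i\<in>UNIV. \<Sum>j\<in>UNIV. Re (cnj (Y$i$j) * (\<rho> ** Y)$i$j))"
    by (simp add: inner_vec_def inner_complex_def)
  also have "\<dots> = (\<Sum>j\<in>UNIV. \<Sum>i\<in>UNIV. Re (cnj (Y$i$j) * (\<rho> ** Y)$i$j))"
    by (rule sum.swap)
  also have "\<dots> = (\<Sum>j\<in>UNIV. Re (cinner (column j Y) (\<rho> *v column j Y)))"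
    by (simp add: cinner_def column_def matrix_matrix_mult_def matrix_vector_mult_def)
  finally show ?thesis .
qed

lemma inner_mult_right:
  fixes Y \<rho> :: "complex^'n^'n"
  shows "Y \<bullet> (Y ** \<rho>) =
    (\<Sum>i\<in>UNIV. Re (cinner (\<chi> k. cnj (Y$i$k)) (\<rho> *v (\<chi> k. cnj (Y$i$k)))))"
proof -
  have *: "(\<Sum>j\<in>UNIV. cnj (Y$i$j) * (Y ** \<rho>)$i$j) =
      cinner (\<chi> k. cnj (Y$i$k)) (\<rho> *v (\<chi> k. cnj (Y$i$k)))" for i
  proof -
    have "(\<Sum>j\<in>UNIV. cnj (Y$i$j) * (Y ** \<rho>)$i$j) =
        (\<Sum>j\<in>UNIV. \<Sum>k\<in>UNIV. cnj (Y$i$j) * (Y$i$k * \<rho>$k$j))"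
      by (simp add: matrix_matrix_mult_def sum_distrib_left)
    also have "\<dots> = (\<Sum>k\<in>UNIV. \<Sum>j\<in>UNIV. cnj (Y$i$j) * (Y$i$k * \<rho>$k$j))"
      by (rule sum.swap)
    also have "\<dots> = cinner (\<chi> k. cnj (Y$i$k)) (\<rho> *v (\<chi> k. cnj (Y$i$k)))"
      by (simp add: cinner_def matrix_vector_mult_def sum_distrib_left mult_ac)
    finally show ?thesis .
  qed
  have "Y \<bullet> (Y ** \<rho>) = (\<Sum>i\<in>UNIV. Re (\<Sum>j\<in>UNIV. cnj (Y$i$j) * (Y ** \<rho>)$i$j))"
    by (simp add: inner_vec_def inner_complex_def)
  then show ?thesis by (simp only: *)
qed

lemma sylvester_coercive:
  fixes \<rho> :: "complex^'n^'n"
  assumes "positive_definite \<rho>"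
  obtains c where "c > 0"
    "\<And>s Y. s \<ge> 0 \<Longrightarrow> c * norm Y \<le> norm (sylvester s \<rho> Y)"
proof -
  let ?f = "\<lambda>Y::complex^'n^'n. Y \<bullet> (\<rho> ** Y)"
  have q0: "0 \<le> Re (cinner v (\<rho> *v v))" for v
    using assms by (cases "v = 0") (auto simp: positive_definite_def less_imp_le cinner_def)
  have pos: "0 < ?f Y" if "Y \<noteq> 0" for Y
  proof -
    from that obtain j where "column j Y \<noteq> 0"
      by (auto simp: vec_eq_iff column_def)
    then show ?thesis unfolding inner_mult_left using assms q0
      by (intro sum_pos2[of _ j]) (auto simp: positive_definite_def)
  qed
  have "linear (\<lambda>Y::complex^'n^'n. \<rho> ** Y)"
    using linear_sylvester[of 0 \<rho>] by (simp add: sylvester_def[abs_def])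
  then have "bounded_linear (\<lambda>Y::complex^'n^'n. \<rho> ** Y)"
    by (simp only: linear_linear)
  then have cont: "continuous_on (sphere 0 1) ?f"
    by (intro continuous_intros linear_continuous_on)
  obtain Y0 :: "complex^'n^'n" where Y0: "Y0 \<in> sphere 0 1"
      "\<And>Y. Y \<in> sphere 0 1 \<Longrightarrow> ?f Y0 \<le> ?f Y"
    using continuous_attains_inf[OF compact_sphere _ cont] by auto
  define c where "c = ?f Y0"
  have "c > 0" unfolding c_def using Y0(1) by (intro pos) auto
  moreover have "c * norm Y \<le> norm (sylvester s \<rho> Y)" if "s \<ge> 0" for s Y
  proof (cases "Y = 0")
    case False
    define Z where "Z = Y /\<^sub>R norm Y"
    have Y: "Y = norm Y *\<^sub>R Z" using False by (simp add: Z_def)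
    have "c \<le> ?f Z" unfolding c_def using False by (intro Y0(2)) (simp add: Z_def)
    also have "?f Z \<le> Z \<bullet> sylvester s \<rho> Z"
      unfolding sylvester_def inner_add_right inner_scaleR_right inner_mult_right
      using q0 that by (simp add: sum_nonneg)
    also have "\<dots> \<le> norm Z * norm (sylvester s \<rho> Z)"
      by (rule norm_cauchy_schwarz)
    also have "\<dots> = norm (sylvester s \<rho> Z)" using False by (simp add: Z_def)
    finally have "norm Y * c \<le> norm Y * norm (sylvester s \<rho> Z)"
      by (simp add: mult_left_mono)
    also have "\<dots> = norm (sylvester s \<rho> Y)"
      using linear_cmul[OF linear_sylvester, of s \<rho> "norm Y" Z] by (simp flip: Y)
    finally show ?thesis by (simp add: mult.commute)
  qed simp
  ultimately show thesis by (rule that)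
qed

lemma sylvester_ex1:
  fixes \<rho> :: "complex^'n^'n"
  assumes "positive_definite \<rho>" "s \<ge> 0"
  shows "\<exists>!X. sylvester s \<rho> X = \<delta>\<rho>"
proof -
  obtain c where c: "c > 0" "\<And>s Y. s \<ge> 0 \<Longrightarrow> c * norm Y \<le> norm (sylvester s \<rho> Y)"
    using sylvester_coercive[OF assms(1)] by blast
  have inj: "inj (sylvester s \<rho>)"
    unfolding linear_injective_0[OF linear_sylvester]
  proof (intro allI impI)
    fix Y assume "sylvester s \<rho> Y = 0"
    with c(2)[OF assms(2), of Y] have "c * norm Y \<le> 0" by simp
    with c(1) show "Y = 0" by (simp add: mult_le_0_iff)
  qed
  then have "surj (sylvester s \<rho>)"
    by (rule linear_injective_imp_surjective[OF linear_sylvester]) simp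
  with inj show ?thesis by (metis injD surjD)
qed

lemma sylvester_solution:
  assumes "positive_definite \<rho>" "s \<ge> 0"
  shows "sylvester s \<rho> (sylvester_solution s \<rho> \<delta>\<rho>) = \<delta>\<rho>"
  unfolding sylvester_solution_def by (rule theI') (rule sylvester_ex1[OF assms])

lemma continuous_on_sylvester_solution:
  assumes "positive_definite \<rho>"
  shows "continuous_on {0..} (\<lambda>s. sylvester_solution s \<rho> \<delta>\<rho>)"
proof -
  let ?X = "\<lambda>s. sylvester_solution s \<rho> \<delta>\<rho>"
  obtain c where c: "c > 0" "\<And>s Y. s \<ge> 0 \<Longrightarrow> c * norm Y \<le> norm (sylvester s \<rho> Y)"
    using sylvester_coercive[OF assms] by blast
  have est: "norm (?X s - ?X u) \<le> \<bar>s - u\<bar> * norm (?X u ** \<rho>) / c" if "s \<ge> 0" "u \<ge> 0" for s u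
  proof -
    have "sylvester s \<rho> (?X u) = sylvester u \<rho> (?X u) + (s - u) *\<^sub>R (?X u ** \<rho>)"
      by (simp add: sylvester_def algebra_simps)
    then have "sylvester s \<rho> (?X s - ?X u) = - ((s - u) *\<^sub>R (?X u ** \<rho>))"
      using that by (simp add: linear_diff[OF linear_sylvester] sylvester_solution[OF assms])
    then have "c * norm (?X s - ?X u) \<le> \<bar>s - u\<bar> * norm (?X u ** \<rho>)"
      using c(2)[OF that(1), of "?X s - ?X u"] by simp
    with c(1) show ?thesis by (simp add: field_simps)
  qed
  show ?thesis unfolding continuous_on_def
  proof
    fix u :: real assume u: "u \<in> {0..}"
    have "((\<lambda>s. \<bar>s - u\<bar> * norm (?X u ** \<rho>) / c) \<longlongrightarrow> \<bar>u - u\<bar> * norm (?X u ** \<rho>) / c)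
        (at u within {0..})"
      using c(1) by (intro tendsto_intros) auto
    then have lim: "((\<lambda>s. \<bar>s - u\<bar> * norm (?X u ** \<rho>) / c) \<longlongrightarrow> 0) (at u within {0..})"
      by simp
    have "\<forall>\<^sub>F s in at u within {0..}. norm (?X s - ?X u) \<le> \<bar>s - u\<bar> * norm (?X u ** \<rho>) / c"
      unfolding eventually_at_filter by (rule always_eventually) (use est u in auto)
    from Lim_null_comparison[OF this lim]
    have "((\<lambda>s. ?X s - ?X u) \<longlongrightarrow> 0) (at u within {0..})" .
    then show "(?X \<longlongrightarrow> ?X u) (at u within {0..})"
      by (rule LIM_zero_cancel)
  qed
qed

lemma continuous_on_metric_density:
  assumes "positive_definite \<rho>"
  shows "continuous_on {0..1} (metric_density \<rho> \<delta>\<rho>)"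
proof -
  have X: "continuous_on {0..1} (\<lambda>s. sylvester_solution s \<rho> \<delta>\<rho>)"
    by (rule continuous_on_subset[OF continuous_on_sylvester_solution[OF assms]]) auto
  show ?thesis
    unfolding metric_density_def Let_def trace_def matrix_matrix_mult_def dagger_def
    by (simp, intro continuous_intros X, simp_all)
qed

lemma integrable_metric_density:
  assumes "positive_definite \<rho>" "finite_measure_on_unit_interval m"
  shows "integrable m (metric_density \<rho> \<delta>\<rho>)"
proof -
  interpret finite_measure m using assms(2) by (simp add: finite_measure_on_unit_interval_def)
  have sets: "sets m = sets (restrict_space borel {0..1::real})"
    using assms(2) by (simp add: finite_measure_on_unit_interval_def)
  have space: "space m = {0..1}"
    using sets_eq_imp_space_eq[OF sets] by (simp add: space_restrict_space)
  have cont: "continuous_on {0..1} (metric_density \<rho> \<delta>\<rho>)"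
    by (rule continuous_on_metric_density[OF assms(1)])
  have "bounded (metric_density \<rho> \<delta>\<rho> ` {0..1})"
    by (rule compact_imp_bounded[OF compact_continuous_image[OF cont]]) simp
  then obtain B where B: "\<And>s. s \<in> {0..1} \<Longrightarrow> norm (metric_density \<rho> \<delta>\<rho> s) \<le> B"
    unfolding bounded_iff by blast
  have meas: "metric_density \<rho> \<delta>\<rho> \<in> borel_measurable m"
    unfolding measurable_cong_sets[OF sets refl]
    by (rule borel_measurable_continuous_on_restrict[OF cont])
  show ?thesis
    by (rule integrable_const_bound[where B = B]) (use B meas space in auto)
qed

end

theory Submission
  imports Defs
begin

text \<open>With \<open>\<L>\<close> the Lindbladian, the derivative of \<open>Tr(\<delta>\<rho> \<omega>)\<close> is
  \<open>Tr(\<L>(\<delta>\<rho>) (\<omega> + \<omega>\<^sup>\<dagger>)) - s Tr(\<L>(\<rho>) \<omega>\<^sup>\<dagger> \<omega>) - Tr(\<L>(\<rho>) \<omega> \<omega>\<^sup>\<dagger>)\<close>.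
  Substitute \<open>\<delta>\<rho> = s \<omega> \<rho> + \<rho> \<omega>\<close> in the pairing with \<open>\<omega>\<^sup>\<dagger>\<close>, and its adjoint
  \<open>\<delta>\<rho> = s \<rho> \<omega>\<^sup>\<dagger> + \<omega>\<^sup>\<dagger> \<rho>\<close> in the pairing with \<open>\<omega>\<close>.  The terms regroup into \<open>s\<close> times the
  dissipation form of \<open>\<L>\<close> at \<open>\<omega>\<close> plus the same form at \<open>\<omega>\<^sup>\<dagger>\<close>; in each of these the
  Hamiltonian part cancels and only the commutators with the \<open>L k\<close> survive.\<close>

section \<open>Bilinearity of product, trace pairing and Sylvester map; adjoints and
  positivity\<close>

lemma bounded_bilinear_matrix_mult:
  "bounded_bilinear ((**) :: complex^'n^'m \<Rightarrow> complex^'p^'n \<Rightarrow> complex^'p^'m)"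
proof -
  have "((X + Y) ** Z) = X ** Z + Y ** Z" for X Y :: "complex^'n^'m" and Z :: "complex^'p^'n"
    by (simp add: vec_eq_iff matrix_matrix_mult_def distrib_right sum.distrib)
  then show ?thesis
    unfolding bilinear_conv_bounded_bilinear[symmetric] bilinear_def
    by (auto intro!: linearI simp: matrix_add_ldistrib scalar_matrix_assoc matrix_scalar_ac)
qed

lemmas matrix_mult_bilinear_simps =
  bounded_bilinear.add_left[OF bounded_bilinear_matrix_mult]
  bounded_bilinear.add_right[OF bounded_bilinear_matrix_mult]
  bounded_bilinear.diff_left[OF bounded_bilinear_matrix_mult]
  bounded_bilinear.diff_right[OF bounded_bilinear_matrix_mult]
  bounded_bilinear.minus_left[OF bounded_bilinear_matrix_mult]
  bounded_bilinear.minus_right[OF bounded_bilinear_matrix_mult]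
  bounded_bilinear.scaleR_left[OF bounded_bilinear_matrix_mult]
  bounded_bilinear.scaleR_right[OF bounded_bilinear_matrix_mult]
  bounded_bilinear.sum_left[OF bounded_bilinear_matrix_mult]
  bounded_bilinear.sum_right[OF bounded_bilinear_matrix_mult]

lemma linear_trace: "linear (trace :: complex^'n^'n \<Rightarrow> complex)"
  by (rule linearI) (simp_all add: trace_def sum.distrib scaleR_sum_right)

lemmas trace_linear_simps =
  linear_add[OF linear_trace] linear_diff[OF linear_trace] linear_cmul[OF linear_trace]
  linear_sum[OF linear_trace] linear_neg[OF linear_trace]

lemma bounded_bilinear_trace_mult:
  "bounded_bilinear (\<lambda>X Y :: complex^'n^'n. trace (X ** Y))"
  unfolding bilinear_conv_bounded_bilinear[symmetric] bilinear_def
  by (auto intro!: linearI simp: matrix_mult_bilinear_simps trace_linear_simps)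

lemma bounded_bilinear_sylvester:
  "bounded_bilinear (sylvester s :: complex^'n^'n \<Rightarrow> _)"
  unfolding bilinear_conv_bounded_bilinear[symmetric] bilinear_def
  by (auto intro!: linearI simp: sylvester_def matrix_mult_bilinear_simps algebra_simps)

lemma trace_mat_mult: "trace (mat c ** A) = c * trace A" for A :: "complex^'n^'n"
proof -
  have "(mat c ** A) $ i $ j = c * A $ i $ j" for i j
    by (simp add: matrix_matrix_mult_def mat_def if_distrib if_distribR cong: if_cong)
  then show ?thesis by (simp add: trace_def sum_distrib_left)
qed

lemma dagger_dagger [simp]: "dagger (dagger A) = A"
  by (simp add: dagger_def)

lemma dagger_mult: "dagger (A ** B) = dagger B ** dagger A"
  by (simp add: dagger_def matrix_matrix_mult_def vec_eq_iff mult.commute)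

lemma dagger_add: "dagger (A + B) = dagger A + dagger B"
  by (simp add: dagger_def vec_eq_iff)

lemma dagger_diff: "dagger (A - B) = dagger A - dagger B"
  by (simp add: dagger_def vec_eq_iff)

lemma dagger_scaleR: "dagger (r *\<^sub>R A) = r *\<^sub>R dagger A"
  by (simp add: dagger_def vec_eq_iff)

lemma trace_dagger: "trace (dagger A) = cnj (trace A)"
  by (simp add: dagger_def trace_def)

lemma Re_trace_mult_dagger: "Re (trace (A ** dagger B)) = B \<bullet> A"
  by (simp add: trace_def matrix_matrix_mult_def dagger_def inner_vec_def inner_complex_def
      algebra_simps)

text \<open>Since \<rho> is self-adjoint, so is \<open>C ** \<rho> ** dagger C\<close>, and its
  trace is real. By \<open>Re_trace_mult_dagger\<close> and \<open>inner_mult_right\<close> the real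
  part is the sum, over the rows of \<open>C\<close>, of the quadratic form of \<rho> at the
  conjugated row.\<close>

lemma trace_sandwich_nonneg:
  assumes "positive_definite \<rho>"
  shows "trace (C ** \<rho> ** dagger C) \<in> \<real>" "0 \<le> Re (trace (C ** \<rho> ** dagger C))"
proof -
  have sa: "dagger \<rho> = \<rho>" and pos: "0 \<le> Re (cinner v (\<rho> *v v))" for v
    using assms by (cases "v = 0"; force simp: positive_definite_def self_adjoint_def cinner_def)+
  show "trace (C ** \<rho> ** dagger C) \<in> \<real>"
    by (simp add: Reals_cnj_iff sa dagger_mult matrix_mul_assoc flip: trace_dagger)
  show "0 \<le> Re (trace (C ** \<rho> ** dagger C))"
    unfolding Re_trace_mult_dagger inner_mult_right by (intro sum_nonneg pos)
qed

section \<open>The Lindbladian under the trace\<close>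

text \<open>Expands the pairing into traces of plain matrix words, so that later identities reduce
  to cyclicity of the trace and scalar algebra.\<close>

lemma trace_lindbladian_mult:
  "trace (lindbladian H K L X ** Y) =
    - \<i> * (trace (H ** X ** Y) - trace (X ** H ** Y))
    - (\<Sum>k\<in>K. trace (dagger (L k) ** L k ** X ** Y) / 2
        + trace (X ** dagger (L k) ** L k ** Y) / 2 - trace (L k ** X ** dagger (L k) ** Y))"
proof -
  have "trace ((mat (- \<i>) ** commutator H X) ** Y)
      = - \<i> * (trace (H ** X ** Y) - trace (X ** H ** Y))"
    unfolding commutator_def
    by (simp only: trace_mat_mult matrix_mul_assoc[symmetric] matrix_mult_bilinear_simps
        trace_linear_simps right_diff_distrib)
  moreover have "trace (((1/2) *\<^sub>R (\<Sum>k\<in>K. dagger (L k) ** L k ** X + X ** dagger (L k) ** L k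
        - 2 *\<^sub>R (L k ** X ** dagger (L k)))) ** Y)
      = (\<Sum>k\<in>K. trace (dagger (L k) ** L k ** X ** Y) / 2
        + trace (X ** dagger (L k) ** L k ** Y) / 2 - trace (L k ** X ** dagger (L k) ** Y))"
    unfolding matrix_mult_bilinear_simps trace_linear_simps scaleR_sum_right
    by (intro sum.cong refl) (simp add: scaleR_conv_of_real[where 'a=complex] algebra_simps)
  ultimately show ?thesis
    unfolding lindbladian_def by (simp only: matrix_mult_bilinear_simps trace_linear_simps)
qed

text \<open>For \<open>B = A\<^sup>\<dagger>\<close> and \<open>\<L>\<^sup>*\<close> the trace dual of \<open>\<L>\<close>, the left-hand side is
  \<open>Tr(\<rho> (A\<^sup>\<dagger> \<L>\<^sup>*(A) + \<L>\<^sup>*(A\<^sup>\<dagger>) A - \<L>\<^sup>*(A\<^sup>\<dagger> A)))\<close>.\<close>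
lemma lindbladian_dissipation:
  fixes \<rho> A B :: "complex^'n^'n"
  shows "trace (lindbladian H K L (A ** \<rho>) ** B) + trace (lindbladian H K L (\<rho> ** B) ** A)
      - trace (lindbladian H K L \<rho> ** (B ** A))
    = - (\<Sum>k\<in>K. trace (commutator A (L k) ** \<rho> ** (dagger (L k) ** B - B ** dagger (L k))))"
proof -
  note assoc = matrix_mul_assoc[symmetric]
  \<comment> \<open>Cyclic normal form: each word is rotated until \<rho> comes first, so that
    cyclically equal words become syntactically equal. At most three factors precede \<rho>, as in
    \<open>dagger (L k) ** L k ** A ** \<rho> ** B\<close>.\<close>
  have rotate: "trace (X ** \<rho>) = trace (\<rho> ** X)"
    "trace (X ** (\<rho> ** Y)) = trace (\<rho> ** (Y ** X))"
    "trace (X ** (X' ** (\<rho> ** Y))) = trace (\<rho> ** (Y ** (X ** X')))"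
    "trace (X ** (X' ** (X'' ** (\<rho> ** Y)))) = trace (\<rho> ** (Y ** (X ** (X' ** X''))))"
    for X X' X'' Y
    using trace_mul_sym[of X \<rho>] trace_mul_sym[of X "\<rho> ** Y"]
      trace_mul_sym[of "X ** X'" "\<rho> ** Y"] trace_mul_sym[of "X ** X' ** X''" "\<rho> ** Y"]
    by (simp_all add: assoc)
  show ?thesis
    by (simp add: trace_lindbladian_mult commutator_def matrix_mult_bilinear_simps
        trace_linear_simps assoc rotate sum.distrib sum_subtractf algebra_simps
        flip: sum_divide_distrib)
qed

section \<open>Difference quotients and continuity of the Sylvester solution\<close>

text \<open>Lets derivatives be computed by limit rules for bilinear maps. The quotient at
  \<open>x = t\<close>, where the inverse defaults to 0, is invisible to the limit.\<close>

lemma has_vector_derivative_iff_quotient: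
  fixes f :: "real \<Rightarrow> 'a::real_normed_vector"
  shows "(f has_vector_derivative D) (at t within T) \<longleftrightarrow>
    ((\<lambda>x. (f x - f t) /\<^sub>R (x - t)) \<longlongrightarrow> D) (at t within T)"
proof -
  have *: "norm ((1 / norm (x - t)) *\<^sub>R (f x - (f t + (x - t) *\<^sub>R D)))
      = norm ((f x - f t) /\<^sub>R (x - t) - D)" if "x \<noteq> t" for x
  proof -
    have "(f x - f t) /\<^sub>R (x - t) - D = (f x - (f t + (x - t) *\<^sub>R D)) /\<^sub>R (x - t)"
      using that by (simp add: diff_diff_eq[symmetric] scaleR_diff_right[of _ _ "(x - t) *\<^sub>R D"])
    then show ?thesis by (simp add: divide_inverse)
  qed
  have "(f has_vector_derivative D) (at t within T) \<longleftrightarrow>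
      ((\<lambda>x. norm ((1 / norm (x - t)) *\<^sub>R (f x - (f t + (x - t) *\<^sub>R D)))) \<longlongrightarrow> 0) (at t within T)"
    unfolding has_vector_derivative_def has_derivative_within
    by (simp only: bounded_linear_scaleR_left tendsto_norm_zero_iff simp_thms)
  also have "\<dots> \<longleftrightarrow> ((\<lambda>x. norm ((f x - f t) /\<^sub>R (x - t) - D)) \<longlongrightarrow> 0) (at t within T)"
    by (rule tendsto_cong) (use * in \<open>auto simp: eventually_at_filter\<close>)
  also have "\<dots> \<longleftrightarrow> ((\<lambda>x. (f x - f t) /\<^sub>R (x - t)) \<longlongrightarrow> D) (at t within T)"
    by (simp only: tendsto_norm_zero_iff LIM_zero_iff)
  finally show ?thesis .
qed

text \<open>The left factor vanishes at \<open>t\<close>, so the whole product does, and division by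
  \<open>x - t\<close> can be put on the left factor alone; of the right factor only a limit
  enters.\<close>

lemma (in bounded_bilinear) has_vector_derivative_increment:
  assumes "(g has_vector_derivative g') (at t within T)" "(h \<longlongrightarrow> h0) (at t within T)"
  shows "((\<lambda>x. prod (g x - g t) (h x)) has_vector_derivative prod g' h0) (at t within T)"
proof -
  have "((\<lambda>x. prod ((g x - g t) /\<^sub>R (x - t)) (h x)) \<longlongrightarrow> prod g' h0) (at t within T)"
    using assms by (intro tendsto) (simp_all add: has_vector_derivative_iff_quotient)
  then show ?thesis
    by (simp add: has_vector_derivative_iff_quotient scaleR_left zero_left)
qed

text \<open>Coercivity at \<open>R0\<close> bounds \<open>X x - X0\<close> by its image under
  \<open>sylvester s R0\<close>. Replacing \<open>R0\<close> by \<open>R x\<close> there costs a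
  small multiple of \<open>norm (X x - X0)\<close>; what is left is the residual of
  \<open>X0\<close> in the equation at \<open>x\<close>, which tends to 0.\<close>

lemma tendsto_sylvester_solution:
  fixes R :: "'a \<Rightarrow> complex^'n^'n"
  assumes s: "s \<ge> 0" and pd: "positive_definite R0" "\<forall>\<^sub>F x in F. positive_definite (R x)"
    and R: "(R \<longlongrightarrow> R0) F" and D: "(D \<longlongrightarrow> D0) F"
  shows "((\<lambda>x. sylvester_solution s (R x) (D x)) \<longlongrightarrow> sylvester_solution s R0 D0) F"
proof -
  interpret S: bounded_bilinear "sylvester s :: complex^'n^'n \<Rightarrow> _"
    by (rule bounded_bilinear_sylvester)
  define X where "X x = sylvester_solution s (R x) (D x)" for x
  define X0 where "X0 = sylvester_solution s R0 D0"
  obtain c where c: "c > 0" "\<And>s Y. s \<ge> 0 \<Longrightarrow> c * norm Y \<le> norm (sylvester s R0 Y)"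
    using sylvester_coercive[OF pd(1)] by blast
  obtain B where B: "\<And>a b :: complex^'n^'n. norm (sylvester s a b) \<le> norm a * norm b * B"
    using S.bounded by blast
  have "((\<lambda>x. norm (R x - R0) * B) \<longlongrightarrow> norm (R0 - R0) * B) F"
    by (intro tendsto_intros R)
  then have "\<forall>\<^sub>F x in F. norm (R x - R0) * B < c / 2"
    by (rule order_tendstoD) (use c(1) in simp)
  then have est: "\<forall>\<^sub>F x in F. norm (X x - X0) \<le> norm (D x - sylvester s (R x) X0) * (2 / c)"
    using pd(2)
  proof eventually_elim
    case (elim x)
    let ?Y = "X x - X0"
    have "c * norm ?Y \<le> norm (sylvester s R0 ?Y)"
      using c(2)[OF s] .
    \<comment> \<open>Split \<open>R0\<close> as \<open>R x - (R x - R0)\<close> and use the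
      equation \<open>sylvester s (R x) (X x) = D x\<close>.\<close>
    also have "sylvester s R0 ?Y = (D x - sylvester s (R x) X0) - sylvester s (R x - R0) ?Y"
      using sylvester_solution[OF elim(2) s, of "D x"]
      by (simp add: S.diff_left S.diff_right X_def)
    also have "norm \<dots> \<le> norm (D x - sylvester s (R x) X0) + norm (sylvester s (R x - R0) ?Y)"
      by (rule norm_triangle_ineq4)
    also have "norm (sylvester s (R x - R0) ?Y) \<le> (norm (R x - R0) * B) * norm ?Y"
      using B[of "R x - R0" ?Y] by (simp add: mult_ac)
    \<comment> \<open>Half of the lower bound \<open>c * norm ?Y\<close> absorbs this term; the
      other half yields the factor \<open>2 / c\<close>.\<close>
    also have "\<dots> \<le> c / 2 * norm ?Y"
      using elim(1) by (intro mult_right_mono) auto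
    finally show ?case using c(1) by (simp add: field_simps)
  qed
  have "((\<lambda>x. norm (D x - sylvester s (R x) X0) * (2 / c))
      \<longlongrightarrow> norm (D0 - sylvester s R0 X0) * (2 / c)) F"
    by (intro tendsto_intros R D S.tendsto)
  then have "((\<lambda>x. norm (D x - sylvester s (R x) X0) * (2 / c)) \<longlongrightarrow> 0) F"
    using sylvester_solution[OF pd(1) s, of D0] by (simp add: X0_def)
  from Lim_null_comparison[OF est this]
  have "((\<lambda>x. X x - X0) \<longlongrightarrow> 0) F" .
  then show ?thesis unfolding X_def X0_def by (rule LIM_zero_cancel)
qed

section \<open>Duality for the Sylvester map and the derivative of the trace\<close>

text \<open>Cyclicity moves \<rho> from the front of \<open>dagger X ** Y\<close> to its end. This
  is the symmetry of the Sylvester map in the Hilbert-Schmidt form; it allows testing the equation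
  at one time against the solution at another.\<close>

lemma trace_sylvester_dual:
  assumes "self_adjoint \<rho>"
  shows "trace (dagger (sylvester s \<rho> X) ** Y) = trace (dagger X ** sylvester s \<rho> Y)"
proof -
  have "trace (\<rho> ** (dagger X ** Y)) = trace (dagger X ** (Y ** \<rho>))"
    using trace_mul_sym[of \<rho> "dagger X ** Y"] by (simp add: matrix_mul_assoc)
  then show ?thesis
    using assms
    by (simp add: sylvester_def self_adjoint_def dagger_add dagger_scaleR dagger_mult
        matrix_mult_bilinear_simps trace_linear_simps matrix_mul_assoc[symmetric])
qed

text \<open>Duality with both arguments equal to \<omega>. It is the reason why both traces in the
  theorem have the same derivative.\<close>

lemma trace_sylvester_solution_symmetric:
  assumes "positive_definite \<rho>" "s \<ge> 0" "self_adjoint \<delta>\<rho>"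
  defines "\<omega> \<equiv> sylvester_solution s \<rho> \<delta>\<rho>"
  shows "trace (\<delta>\<rho> ** dagger \<omega>) = trace (\<delta>\<rho> ** \<omega>)"
proof -
  have sa: "self_adjoint \<rho>" and eq: "sylvester s \<rho> \<omega> = \<delta>\<rho>"
    using assms sylvester_solution[OF assms(1,2)] by (auto simp: positive_definite_def)
  have "trace (\<delta>\<rho> ** \<omega>) = trace (dagger \<omega> ** \<delta>\<rho>)"
    using trace_sylvester_dual[OF sa, of s \<omega> \<omega>] assms(3) by (simp add: eq self_adjoint_def)
  then show ?thesis using trace_mul_sym[of "dagger \<omega>" \<delta>\<rho>] by simp
qed

text \<open>Pairing the Sylvester equation at time \<open>x\<close> with the solution at time \<open>t\<close> makes the increment
  of the trace first order in \<open>\<delta>\<rho> x - \<delta>\<rho> t\<close> and \<open>\<rho> x - \<rho> t\<close>, with coefficients that only involve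
  \<open>\<omega> x\<close> itself.  So continuity of \<open>\<omega>\<close> suffices.\<close>
lemma has_vector_derivative_trace_sylvester_solution:
  fixes \<rho> \<delta>\<rho> :: "real \<Rightarrow> complex^'n^'n"
  assumes s: "s \<ge> 0" and t: "t \<in> T"
    and pd: "\<And>x. x \<in> T \<Longrightarrow> positive_definite (\<rho> x)"
    and sa: "\<And>x. x \<in> T \<Longrightarrow> self_adjoint (\<delta>\<rho> x)"
    and \<rho>': "(\<rho> has_vector_derivative \<rho>') (at t within T)"
    and \<delta>\<rho>': "(\<delta>\<rho> has_vector_derivative \<delta>\<rho>') (at t within T)"
  defines "\<omega> \<equiv> \<lambda>x. sylvester_solution s (\<rho> x) (\<delta>\<rho> x)"
  shows "((\<lambda>x. trace (\<delta>\<rho> x ** \<omega> x)) has_vector_derivative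
    trace (\<delta>\<rho>' ** \<omega> t) + trace (\<delta>\<rho>' ** dagger (\<omega> t))
      - trace (dagger (\<omega> t) ** sylvester s \<rho>' (\<omega> t))) (at t within T)"
proof -
  interpret P: bounded_bilinear "\<lambda>X Y :: complex^'n^'n. trace (X ** Y)"
    by (rule bounded_bilinear_trace_mult)
  interpret S: bounded_bilinear "sylvester s :: complex^'n^'n \<Rightarrow> _"
    by (rule bounded_bilinear_sylvester)
  interpret PS: bounded_bilinear "\<lambda>X Y. trace (dagger (\<omega> t) ** sylvester s X Y)"
    unfolding bilinear_conv_bounded_bilinear[symmetric] bilinear_def
    by (auto intro!: linearI simp: S.add_left S.add_right S.scaleR_left S.scaleR_right
        P.add_right P.scaleR_right)
  have eq: "sylvester s (\<rho> x) (\<omega> x) = \<delta>\<rho> x" if "x \<in> T" for x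
    unfolding \<omega>_def using sylvester_solution[OF pd[OF that] s] .
  have cont: "(f \<longlongrightarrow> f t) (at t within T)"
    if "(f has_vector_derivative f') (at t within T)" for f f' and T :: "real set"
    using has_vector_derivative_continuous[OF that] by (simp add: continuous_within)
  have \<omega>_lim: "(\<omega> \<longlongrightarrow> \<omega> t) (at t within T)"
    unfolding \<omega>_def
    by (rule tendsto_sylvester_solution[OF s pd[OF t] _ cont[OF \<rho>'] cont[OF \<delta>\<rho>']])
      (simp add: eventually_at_filter pd)
  \<comment> \<open>By duality \<open>trace (\<delta>\<rho> t ** \<omega> x)\<close> is \<open>trace
    (dagger (\<omega> t) ** sylvester s (\<rho> t) (\<omega> x))\<close>. Writing
    \<open>\<rho> t\<close> as \<open>\<rho> x - (\<rho> x - \<rho> t)\<close> and using the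
    equation at \<open>x\<close> turns \<open>trace (\<delta>\<rho> x ** \<omega> x)\<close> into
    this expression.\<close>
  let ?g = "\<lambda>x. trace (\<delta>\<rho> t ** \<omega> t) + trace ((\<delta>\<rho> x - \<delta>\<rho> t) ** \<omega> x)
      + trace ((\<delta>\<rho> x - \<delta>\<rho> t) ** dagger (\<omega> t))
      - trace (dagger (\<omega> t) ** sylvester s (\<rho> x - \<rho> t) (\<omega> x))"
  have "(?g has_vector_derivative 0 + trace (\<delta>\<rho>' ** \<omega> t) + trace (\<delta>\<rho>' ** dagger (\<omega> t))
      - trace (dagger (\<omega> t) ** sylvester s \<rho>' (\<omega> t))) (at t within T)"
    by (intro has_vector_derivative_add has_vector_derivative_diff has_vector_derivative_const
        P.has_vector_derivative_increment PS.has_vector_derivative_increment \<rho>' \<delta>\<rho>' \<omega>_lim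
        tendsto_const)
  moreover have "?g x = trace (\<delta>\<rho> x ** \<omega> x)" if x: "x \<in> T" for x
  proof -
    have sa\<rho>: "self_adjoint (\<rho> t)" using pd[OF t] by (simp add: positive_definite_def)
    have "trace (\<delta>\<rho> t ** \<omega> x) = trace (dagger (\<omega> t) ** sylvester s (\<rho> t) (\<omega> x))"
      using trace_sylvester_dual[OF sa\<rho>, of s "\<omega> t" "\<omega> x"] eq[OF t] sa[OF t]
      by (simp add: self_adjoint_def)
    moreover have "trace (\<delta>\<rho> t ** dagger (\<omega> t)) = trace (\<delta>\<rho> t ** \<omega> t)"
      unfolding \<omega>_def by (rule trace_sylvester_solution_symmetric[OF pd[OF t] s sa[OF t]])
    ultimately show ?thesis
      using eq[OF x] by (simp add: S.diff_left P.diff_left P.diff_right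
          trace_mul_sym[of "\<delta>\<rho> x" "dagger (\<omega> t)"])
  qed
  ultimately show ?thesis
    using has_vector_derivative_transform[OF t, of "\<lambda>x. trace (\<delta>\<rho> x ** \<omega> x)" ?g] by simp
qed

section \<open>The dissipation formula along the flow\<close>

lemma lindbladian_trace_derivative:
  fixes \<rho> \<omega> :: "complex^'n^'n"
  assumes "self_adjoint \<rho>" "self_adjoint \<delta>\<rho>" and eq: "sylvester s \<rho> \<omega> = \<delta>\<rho>"
  shows "trace (lindbladian H K L \<delta>\<rho> ** \<omega>) + trace (lindbladian H K L \<delta>\<rho> ** dagger \<omega>)
      - trace (dagger \<omega> ** sylvester s (lindbladian H K L \<rho>) \<omega>)
    = - of_real s * (\<Sum>k\<in>K. trace (commutator \<omega> (L k) ** \<rho> ** dagger (commutator \<omega> (L k))))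
      - (\<Sum>k\<in>K. trace (commutator (dagger \<omega>) (L k) ** \<rho>
                       ** dagger (commutator (dagger \<omega>) (L k))))"
proof -
  let ?L = "lindbladian H K L"
  have lin: "trace (?L (s *\<^sub>R X + Y) ** Z) = of_real s * trace (?L X ** Z) + trace (?L Y ** Z)"
    for X Y Z
    unfolding trace_lindbladian_mult
    by (simp add: matrix_mult_bilinear_simps trace_linear_simps scaleR_conv_of_real[where 'a=complex]
        sum.distrib sum_subtractf sum_distrib_left algebra_simps add_divide_distrib)
  have dag: "dagger (commutator A (L k)) = dagger (L k) ** dagger A - dagger A ** dagger (L k)"
    for A k
    by (simp add: commutator_def dagger_diff dagger_mult)
  have \<delta>1: "\<delta>\<rho> = s *\<^sub>R (\<omega> ** \<rho>) + \<rho> ** \<omega>"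
    using eq by (simp add: sylvester_def)
  have "\<delta>\<rho> = dagger (s *\<^sub>R (\<omega> ** \<rho>) + \<rho> ** \<omega>)"
    using assms(2) \<delta>1 by (simp add: self_adjoint_def)
  then have \<delta>2: "\<delta>\<rho> = s *\<^sub>R (\<rho> ** dagger \<omega>) + dagger \<omega> ** \<rho>"
    using assms(1) by (simp add: self_adjoint_def dagger_add dagger_scaleR dagger_mult)
  \<comment> \<open>The two summands are the subtracted terms of
    \<open>lindbladian_dissipation\<close> at \<omega> and at
    \<open>dagger \<omega>\<close>.\<close>
  have "trace (dagger \<omega> ** sylvester s (?L \<rho>) \<omega>)
      = of_real s * trace (?L \<rho> ** (dagger \<omega> ** \<omega>)) + trace (?L \<rho> ** (\<omega> ** dagger \<omega>))"
    using trace_mul_sym[of "dagger \<omega> ** \<omega>" "?L \<rho>"] trace_mul_sym[of "dagger \<omega>" "?L \<rho> ** \<omega>"]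
    by (simp add: sylvester_def matrix_mult_bilinear_simps trace_linear_simps
        scaleR_conv_of_real[where 'a=complex] matrix_mul_assoc)
  moreover have "trace (?L \<delta>\<rho> ** dagger \<omega>)
      = of_real s * trace (?L (\<omega> ** \<rho>) ** dagger \<omega>) + trace (?L (\<rho> ** \<omega>) ** dagger \<omega>)"
    by (subst \<delta>1) (rule lin)
  moreover have "trace (?L \<delta>\<rho> ** \<omega>)
      = of_real s * trace (?L (\<rho> ** dagger \<omega>) ** \<omega>) + trace (?L (dagger \<omega> ** \<rho>) ** \<omega>)"
    by (subst \<delta>2) (rule lin)
  \<comment> \<open>The claim is \<open>s\<close> times the first instance plus the second.\<close>
  moreover note lindbladian_dissipation[of H K L \<omega> \<rho> "dagger \<omega>"]
    lindbladian_dissipation[of H K L "dagger \<omega>" \<rho> \<omega>]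
  ultimately show ?thesis
    unfolding dag dagger_dagger by algebra
qed

section \<open>Monotonicity of the metric\<close>

text \<open>Both halves of the symmetrised solution pair equally with \<delta>\<rho>, so the
  derivative of \<open>trace (\<delta>\<rho> ** \<omega>)\<close> governs the density.\<close>

lemma metric_density_eq:
  assumes "positive_definite \<rho>" "s \<ge> 0" "self_adjoint \<delta>\<rho>"
  shows "metric_density \<rho> \<delta>\<rho> s = Re (trace (\<delta>\<rho> ** sylvester_solution s \<rho> \<delta>\<rho>))"
  using trace_sylvester_solution_symmetric[OF assms]
  by (simp add: metric_density_def matrix_mult_bilinear_simps trace_linear_simps)

text \<open>Mean value theorem on \<open>{a..b}\<close>, which lies in \<open>T\<close> because
  \<open>T\<close> is an interval. Derivatives within \<open>T\<close> restrict to
  \<open>{a..b}\<close>, so endpoints belonging to \<open>T\<close> are covered.\<close>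

lemma antimono_on_of_vector_derivative_nonpos:
  fixes f :: "real \<Rightarrow> real"
  assumes T: "is_interval T"
    and f: "\<And>t. t \<in> T \<Longrightarrow> \<exists>D\<le>0. (f has_vector_derivative D) (at t within T)"
  shows "antimono_on T f"
proof (rule monotone_onI)
  fix a b assume ab: "a \<in> T" "b \<in> T" "a \<le> b"
  then have sub: "{a..b} \<subseteq> T"
    using mem_is_interval_1_I[OF T] by (meson atLeastAtMost_iff subsetI)
  obtain D where D: "\<And>t. t \<in> T \<Longrightarrow> D t \<le> 0 \<and> (f has_vector_derivative D t) (at t within T)"
    using f by metis
  have "\<exists>x\<in>{a..b}. f b - f a = (b - a) *\<^sub>R D x"
  proof (rule mvt_very_simple[OF ab(3)])
    fix x assume "a \<le> x" "x \<le> b"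
    with sub have "(f has_vector_derivative D x) (at x within T)"
      by (intro D[THEN conjunct2]) auto
    from has_vector_derivative_within_subset[OF this sub]
    show "(f has_derivative (\<lambda>y. y *\<^sub>R D x)) (at x within {a..b})"
      by (simp only: has_vector_derivative_def)
  qed
  then obtain x where x: "x \<in> {a..b}" "f b - f a = (b - a) * D x" by auto
  with D[of x] sub ab(3) have "(b - a) * D x \<le> 0" by (intro mult_nonneg_nonpos) auto
  with x(2) show "f b \<le> f a" by simp
qed

theorem mainTheorem1:
  fixes H :: "complex^'n^'n"
    and K :: "'k set"
    and L :: "'k \<Rightarrow> complex^'n^'n"
    and T :: "real set"
    and \<rho> \<delta>\<rho> :: "real \<Rightarrow> complex^'n^'n"
  assumes "self_adjoint H"
    and "finite K"
    and "is_interval T"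
    and "\<And>t. t \<in> T \<Longrightarrow> density_operator (\<rho> t) \<and> positive_definite (\<rho> t)"
    and "\<And>t. t \<in> T \<Longrightarrow> self_adjoint (\<delta>\<rho> t) \<and> trace (\<delta>\<rho> t) = 0"
    and "lindblad_solution_on T H K L \<rho>"
    and "lindblad_solution_on T H K L \<delta>\<rho>"
  shows "(\<forall>s\<in>{0..1}. \<forall>t\<in>T.
            let \<omega> = (\<lambda>t. sylvester_solution s (\<rho> t) (\<delta>\<rho> t));
                D = - of_real s * (\<Sum>k\<in>K. trace (commutator (\<omega> t) (L k) ** \<rho> t
                                               ** dagger (commutator (\<omega> t) (L k))))
                    - (\<Sum>k\<in>K. trace (commutator (dagger (\<omega> t)) (L k) ** \<rho> t
                                     ** dagger (commutator (dagger (\<omega> t)) (L k))))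
            in ((\<lambda>t. trace (\<delta>\<rho> t ** \<omega> t)) has_vector_derivative D) (at t within T)
               \<and> ((\<lambda>t. trace (\<delta>\<rho> t ** dagger (\<omega> t))) has_vector_derivative D) (at t within T)
               \<and> D \<in> \<real> \<and> Re D \<le> 0)
         \<and> (\<forall>m. finite_measure_on_unit_interval m \<longrightarrow>
              antimono_on T (\<lambda>t. metric_norm m (\<rho> t) (\<delta>\<rho> t)))"
proof (intro conjI ballI allI impI)
  have pd: "positive_definite (\<rho> t)" and sa\<rho>: "self_adjoint (\<rho> t)" and sa: "self_adjoint (\<delta>\<rho> t)"
    if "t \<in> T" for t
    using assms(4,5)[OF that] by (auto simp: positive_definite_def)
  define \<omega> where "\<omega> s t = sylvester_solution s (\<rho> t) (\<delta>\<rho> t)" for s t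
  define D where "D s t = - of_real s * (\<Sum>k\<in>K. trace (commutator (\<omega> s t) (L k) ** \<rho> t
                                               ** dagger (commutator (\<omega> s t) (L k))))
                    - (\<Sum>k\<in>K. trace (commutator (dagger (\<omega> s t)) (L k) ** \<rho> t
                                     ** dagger (commutator (dagger (\<omega> s t)) (L k))))" for s t
  have der: "((\<lambda>t. trace (\<delta>\<rho> t ** \<omega> s t)) has_vector_derivative D s t) (at t within T)"
    if "0 \<le> s" "t \<in> T" for s t
  proof -
    have \<rho>': "(\<rho> has_vector_derivative lindbladian H K L (\<rho> t)) (at t within T)"
      and \<delta>\<rho>': "(\<delta>\<rho> has_vector_derivative lindbladian H K L (\<delta>\<rho> t)) (at t within T)"
      using assms(6,7) that by (auto simp: lindblad_solution_on_def)
    have "sylvester s (\<rho> t) (\<omega> s t) = \<delta>\<rho> t"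
      unfolding \<omega>_def using sylvester_solution[OF pd[OF that(2)] that(1)] .
    from lindbladian_trace_derivative[OF sa\<rho>[OF that(2)] sa[OF that(2)] this, of H K L]
      has_vector_derivative_trace_sylvester_solution[OF that pd sa \<rho>' \<delta>\<rho>']
    show ?thesis unfolding D_def \<omega>_def by simp
  qed
  have D_real: "D s t \<in> \<real>" and D_nonpos: "Re (D s t) \<le> 0" if "0 \<le> s" "t \<in> T" for s t
  proof -
    note nn = trace_sandwich_nonneg[OF pd[OF that(2)]]
    show "D s t \<in> \<real>"
      unfolding D_def by (intro Reals_diff Reals_mult Reals_minus Reals_of_real sum_in_Reals nn)
    have "0 \<le> s * (\<Sum>k\<in>K. Re (trace (C k ** \<rho> t ** dagger (C k))))"
      "0 \<le> (\<Sum>k\<in>K. Re (trace (C k ** \<rho> t ** dagger (C k))))" for C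
      using that(1) by (auto intro!: mult_nonneg_nonneg sum_nonneg nn)
    from this(1)[of "\<lambda>k. commutator (\<omega> s t) (L k)"]
      this(2)[of "\<lambda>k. commutator (dagger (\<omega> s t)) (L k)"]
    show "Re (D s t) \<le> 0" by (simp add: D_def)
  qed
  {
    fix s t :: real assume s: "s \<in> {0..1}" and t: "t \<in> T"
    \<comment> \<open>The two traces agree on all of \<open>T\<close>, hence share the derivative
      within \<open>T\<close>.\<close>
    have "((\<lambda>t. trace (\<delta>\<rho> t ** dagger (\<omega> s t))) has_vector_derivative D s t) (at t within T)"
      by (rule has_vector_derivative_transform[OF t _ der])
        (use s t pd sa in \<open>auto simp: \<omega>_def trace_sylvester_solution_symmetric\<close>)
    with der[of s t] D_real[of s t] D_nonpos[of s t] s t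
    show "let \<omega> = (\<lambda>t. sylvester_solution s (\<rho> t) (\<delta>\<rho> t));
                D = - of_real s * (\<Sum>k\<in>K. trace (commutator (\<omega> t) (L k) ** \<rho> t
                                               ** dagger (commutator (\<omega> t) (L k))))
                    - (\<Sum>k\<in>K. trace (commutator (dagger (\<omega> t)) (L k) ** \<rho> t
                                     ** dagger (commutator (dagger (\<omega> t)) (L k))))
            in ((\<lambda>t. trace (\<delta>\<rho> t ** \<omega> t)) has_vector_derivative D) (at t within T)
               \<and> ((\<lambda>t. trace (\<delta>\<rho> t ** dagger (\<omega> t))) has_vector_derivative D) (at t within T)
               \<and> D \<in> \<real> \<and> Re D \<le> 0"
      unfolding Let_def D_def \<omega>_def by simp
  }
  fix m :: "real measure" assume m: "finite_measure_on_unit_interval m"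
  have space: "space m = {0..1}"
    using m sets_eq_imp_space_eq[of m "restrict_space borel {0..1}"]
    by (simp add: finite_measure_on_unit_interval_def space_restrict_space)
  \<comment> \<open>Monotonicity is obtained for each fixed \<open>s\<close> and then passes through
    the integral against \<open>m\<close> and the square root.\<close>
  have "antimono_on T (\<lambda>t. metric_density (\<rho> t) (\<delta>\<rho> t) s)" if s: "s \<in> {0..1}" for s
  proof (rule antimono_on_of_vector_derivative_nonpos[OF assms(3)])
    fix t assume t: "t \<in> T"
    have "((\<lambda>t. Re (trace (\<delta>\<rho> t ** \<omega> s t))) has_vector_derivative Re (D s t)) (at t within T)"
      using der[of s t] s t by (auto simp: has_vector_derivative_complex_iff
          has_real_derivative_iff_has_vector_derivative)
    then have "((\<lambda>t. metric_density (\<rho> t) (\<delta>\<rho> t) s) has_vector_derivative Re (D s t))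
        (at t within T)"
      by (rule has_vector_derivative_transform[OF t, rotated])
        (use s pd sa in \<open>auto simp: \<omega>_def metric_density_eq\<close>)
    then show "\<exists>D\<le>0. ((\<lambda>t. metric_density (\<rho> t) (\<delta>\<rho> t) s) has_vector_derivative D)
        (at t within T)"
      using D_nonpos[of s t] s t by auto
  qed
  then show "antimono_on T (\<lambda>t. metric_norm m (\<rho> t) (\<delta>\<rho> t))"
    unfolding metric_norm_def metric_sq_def monotone_on_def
    by (auto intro!: real_sqrt_le_mono integral_mono integrable_metric_density[OF pd m]
        simp: space)
qed

end
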